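(* Let $G$ be a compact Lie group acting linearly on a real Banach space $X$, with averaging map $A:X\to X$ and fixed point set $\mathrm{Fix}(G)$, and let $f:X\to[-\infty,+\infty]$ be a $G$-invariant functional (that is, $f(gu)=f(u)$ for all $u\in X$, $g\in G$). Assume that for all $u,v\in \mathrm{Fix}(G)$ there exist $\rho>0$ and $C>0$ such that $$\frac{f(\zeta+t(z-Az))-f(\zeta)}{t}\ \ge\ -C\|z-Az\|$$ for all $\zeta\in B_\rho(u)\cap \mathrm{Fix}(G)$, all $z\in B_\rho(v)$ and all $t\in\,]0,\rho]$ with $f(\zeta-tAz)\le f(u)+\rho$ (the inequality being understood as $f(\zeta)\le f(\zeta+t(z-Az))+Ct\|z-Az\|$ in $[-\infty,+\infty]$). Let $u\in \mathrm{Fix}(G)$ with $f(u)\in\mathbb{R}$ be a critical point of the restriction $f|_{\mathrm{Fix}(G)}:\mathrm{Fix}(G)\to[-\infty,+\infty]$, i.e. $0\in\partial (f|_{\mathrm{Fix}(G)})(u)$. Then $u$ is a critical point of $f$, i.e. $0\in\partial f(u)$.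
   Context: A compact Lie group $G$ acts linearly on $X$ if there is a continuous action $G\times X\to X$, $(g,u)\mapsto gu$, with each $u\mapsto gu$ linear. $\mathrm{Fix}(G)=\{u\in X: gu=u\ \forall g\in G\}$, a closed subspace of $X$, itself regarded as a Banach space. With $\mu$ the normalized Haar measure of $G$, the averaging map is $Av=\int_G gv\,d\mu(g)$, a continuous linear projection of $X$ onto $\mathrm{Fix}(G)$. $B_\rho(u)$ is the open ball of center $u$ and radius $\rho$. Let $Y$ be a real normed space and $f:Y\to[-\infty,+\infty]$. Set $\mathrm{epi}(f)=\{(u,\xi)\in Y\times\mathbb{R}: f(u)\le\xi\}$, with the metric $d((u,\xi),(w,\mu))=(\|u-w\|^2+(\xi-\mu)^2)^{1/2}$. Generalized directional derivative: let $u\in Y$ with $f(u)\in\mathbb{R}$. For $v\in Y$ and $\varepsilon>0$, $f^\circ_\varepsilon(u;v)$ is the infimum of the $r\in\mathbb{R}$ such that there exist $\delta>0$ and a continuous map $\mathcal V:(B_\delta(u,f(u))\cap\mathrm{epi}(f))\times\,]0,\delta]\to B_\varepsilon(v)$ with $f(\xi+t\mathcal V((\xi,\mu),t))\le\mu+rt$ for all $(\xi,\mu)\in B_\delta(u,f(u))\cap\mathrm{epi}(f)$ and $t\in\,]0,\delta]$ (with $\inf\emptyset=+\infty$); and $f^\circ(u;v)=\sup_{\varepsilon>0}f^\circ_\varepsilon(u;v)$. Subdifferential: $\partial f(u)=\{\alpha\in Y^*:\langle\alpha,v\rangle\le f^\circ(u;v)\ \forall v\in Y\}$. For the restriction $f|_{\mathrm{Fix}(G)}$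 these notions are taken in $Y=\mathrm{Fix}(G)$. *)

theory Defs
  imports "HOL-Analysis.Analysis" "HOL-Algebra.Group_Action"
begin

section \<open>Lie groups\<close>

text \<open>The model space of a chart is the library's \<^term>\<open>Euclidean_space n\<close>, whose points are the
  sequences vanishing from index \<open>n\<close> on. It is used instead of a type of class
  \<open>euclidean_space\<close> because the latter excludes dimension 0, i.e. finite groups. The
  sets \<open>U\<close> below are meant to be open in \<^term>\<open>Euclidean_space n\<close>.\<close>

primrec Ck_on :: "nat \<Rightarrow> nat \<Rightarrow> (nat \<Rightarrow> real) set \<Rightarrow> ((nat \<Rightarrow> real) \<Rightarrow> real) \<Rightarrow> bool" where
  "Ck_on n 0 U h \<longleftrightarrow> continuous_map (subtopology (Euclidean_space n) U) euclideanreal h"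
| "Ck_on n (Suc k) U h \<longleftrightarrow>
     continuous_map (subtopology (Euclidean_space n) U) euclideanreal h \<and>
     (\<exists>D :: nat \<Rightarrow> (nat \<Rightarrow> real) \<Rightarrow> real. \<forall>i<n. Ck_on n k U (D i) \<and>
        (\<forall>x\<in>U. ((\<lambda>s. h (x(i := s))) has_real_derivative D i x) (at (x i))))"

definition smooth_map_on ::
  "nat \<Rightarrow> nat \<Rightarrow> (nat \<Rightarrow> real) set \<Rightarrow> ((nat \<Rightarrow> real) \<Rightarrow> (nat \<Rightarrow> real)) \<Rightarrow> bool" where
  "smooth_map_on n m U F \<longleftrightarrow> (\<forall>j<m. \<forall>k. Ck_on n k U (\<lambda>x. F x j))"

definition is_chart :: "'g topology \<Rightarrow> nat \<Rightarrow> 'g set \<Rightarrow> ('g \<Rightarrow> nat \<Rightarrow> real) \<Rightarrow> bool" where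
  "is_chart T n W c \<longleftrightarrow>
     openin T W \<and> openin (Euclidean_space n) (c ` W) \<and>
     homeomorphic_map (subtopology T W) (subtopology (Euclidean_space n) (c ` W)) c"

definition smooth_atlas ::
  "'g topology \<Rightarrow> nat \<Rightarrow> ('g set \<times> ('g \<Rightarrow> nat \<Rightarrow> real)) set \<Rightarrow> bool" where
  "smooth_atlas T n \<A> \<longleftrightarrow>
     (\<forall>(W, c)\<in>\<A>. is_chart T n W c) \<and>
     (\<Union>(W, c)\<in>\<A>. W) = topspace T \<and>
     (\<forall>(W, c)\<in>\<A>. \<forall>(W', c')\<in>\<A>. smooth_map_on n n (c ` (W \<inter> W')) (c' \<circ> inv_into W c))"

text \<open>The two halves of a point of \<open>\<real>\<^sup>n \<times> \<real>\<^sup>n\<close>, identified with \<open>\<real>\<^sup>n\<^sup>+\<^sup>n\<close>.\<close>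

definition fst_half :: "nat \<Rightarrow> (nat \<Rightarrow> real) \<Rightarrow> (nat \<Rightarrow> real)" where
  "fst_half n x = (\<lambda>i. if i < n then x i else 0)"

definition snd_half :: "nat \<Rightarrow> (nat \<Rightarrow> real) \<Rightarrow> (nat \<Rightarrow> real)" where
  "snd_half n x = (\<lambda>i. if i < n then x (n + i) else 0)"

text \<open>Multiplication and inversion are continuous, and smooth when read in charts.\<close>

locale lie_group = group G for G :: "('g, 'm) monoid_scheme" (structure) +
  fixes T :: "'g topology" and n :: nat and \<A> :: "('g set \<times> ('g \<Rightarrow> nat \<Rightarrow> real)) set"
  assumes topspace_eq: "topspace T = carrier G"
    and Hausdorff: "Hausdorff_space T"
    and second_countable: "second_countable T"
    and atlas: "smooth_atlas T n \<A>"
    and continuous_mult: "continuous_map (prod_topology T T) T (\<lambda>(x, y). x \<otimes> y)"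
    and continuous_inv: "continuous_map T T (\<lambda>x. inv x)"
    and smooth_mult:
      "\<lbrakk>(V, a) \<in> \<A>; (W, b) \<in> \<A>; (Z, c) \<in> \<A>\<rbrakk> \<Longrightarrow>
        smooth_map_on (n + n) n
          {x \<in> topspace (Euclidean_space (n + n)).
             fst_half n x \<in> a ` V \<and> snd_half n x \<in> b ` W \<and>
             inv_into V a (fst_half n x) \<otimes> inv_into W b (snd_half n x) \<in> Z}
          (\<lambda>x. c (inv_into V a (fst_half n x) \<otimes> inv_into W b (snd_half n x)))"
    and smooth_inv:
      "\<lbrakk>(V, a) \<in> \<A>; (W, b) \<in> \<A>\<rbrakk> \<Longrightarrow>
        smooth_map_on n n {x \<in> a ` V. inv (inv_into V a x) \<in> W} (\<lambda>x. b (inv (inv_into V a x)))"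

locale compact_lie_group = lie_group +
  assumes compact: "compact_space T"

section \<open>Linear actions, Haar measure and averaging\<close>

definition acts_linearly ::
  "('g, 'm) monoid_scheme \<Rightarrow> 'g topology \<Rightarrow> ('g \<Rightarrow> 'x \<Rightarrow> 'x::real_normed_vector) \<Rightarrow> bool" where
  "acts_linearly G T \<phi> \<longleftrightarrow>
     group_action G UNIV \<phi> \<and>
     continuous_map (prod_topology T euclidean) euclidean (\<lambda>(g, u). \<phi> g u) \<and>
     (\<forall>g\<in>carrier G. linear (\<phi> g))"

definition Fix_set :: "('g, 'm) monoid_scheme \<Rightarrow> ('g \<Rightarrow> 'x \<Rightarrow> 'x) \<Rightarrow> 'x set" where
  "Fix_set G \<phi> = {u. \<forall>g\<in>carrier G. \<phi> g u = u}"

text \<open>Regularity is not listed: it is automatic for a finite Borel measure on a compact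
  second countable Hausdorff space.\<close>

definition normalized_haar_measure ::
  "('g, 'm) monoid_scheme \<Rightarrow> 'g topology \<Rightarrow> 'g measure \<Rightarrow> bool" where
  "normalized_haar_measure G T \<mu> \<longleftrightarrow>
     sets \<mu> = sigma_sets (topspace T) {U. openin T U} \<and>
     emeasure \<mu> (topspace T) = 1 \<and>
     (\<forall>g\<in>carrier G. \<forall>A\<in>sets \<mu>. emeasure \<mu> ((\<lambda>x. g \<otimes>\<^bsub>G\<^esub> x) ` A) = emeasure \<mu> A)"

text \<open>The library's \<^const>\<open>has_bochner_integral\<close> is restricted to second countable target
  spaces. The following is the same notion for arbitrary normed spaces: Borel measurability
  of \<open>f\<close> is replaced by measurability of the approximation errors, which together with the
  convergence makes \<open>f\<close> almost everywhere strongly measurable.\<close>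

definition bochner_integral_is ::
  "'g measure \<Rightarrow> ('g \<Rightarrow> 'x::real_normed_vector) \<Rightarrow> 'x \<Rightarrow> bool" where
  "bochner_integral_is M f w \<longleftrightarrow>
     (\<exists>s. (\<forall>i::nat. Bochner_Integration.simple_bochner_integrable M (s i)) \<and>
          (\<forall>i. (\<lambda>x. norm (f x - s i x)) \<in> borel_measurable M) \<and>
          (\<lambda>i. \<integral>\<^sup>+x. ennreal (norm (f x - s i x)) \<partial>M) \<longlonglongrightarrow> 0 \<and>
          (\<lambda>i. Bochner_Integration.simple_bochner_integral M (s i)) \<longlonglongrightarrow> w)"

definition averaging_map ::
  "'g measure \<Rightarrow> ('g \<Rightarrow> 'x \<Rightarrow> 'x) \<Rightarrow> 'x \<Rightarrow> 'x::real_normed_vector" where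
  "averaging_map \<mu> \<phi> v = (THE w. bochner_integral_is \<mu> (\<lambda>g. \<phi> g v) w)"

section \<open>Nonsmooth critical points\<close>

text \<open>The normed space is a linear subspace \<open>Y\<close> of the ambient type, since \<open>Fix(G)\<close> is not a
  type; \<open>Y = UNIV\<close> gives the notions in the whole space. Only the values of \<open>f\<close> on \<open>Y\<close>
  matter, so \<open>f\<close> stands for its restriction to \<open>Y\<close>. The library metric on the product
  with \<open>\<real>\<close> is the Euclidean combination of the two metrics.\<close>

definition epi :: "'x set \<Rightarrow> ('x \<Rightarrow> ereal) \<Rightarrow> ('x \<times> real) set" where
  "epi Y f = {(u, \<xi>). u \<in> Y \<and> f u \<le> ereal \<xi>}"

text \<open>The following notions are meant for \<open>u \<in> Y\<close> with \<open>f u\<close> finite.\<close>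

definition gen_deriv_eps ::
  "'x::real_normed_vector set \<Rightarrow> ('x \<Rightarrow> ereal) \<Rightarrow> real \<Rightarrow> 'x \<Rightarrow> 'x \<Rightarrow> ereal" where
  "gen_deriv_eps Y f \<epsilon> u v =
     Inf {ereal r | r. \<exists>\<delta>>0. \<exists>\<V>.
       let N = ball (u, real_of_ereal (f u)) \<delta> \<inter> epi Y f in
         continuous_on (N \<times> {0<..\<delta>}) \<V> \<and>
         \<V> ` (N \<times> {0<..\<delta>}) \<subseteq> ball v \<epsilon> \<inter> Y \<and>
         (\<forall>(\<xi>, \<mu>)\<in>N. \<forall>t\<in>{0<..\<delta>}. f (\<xi> + t *\<^sub>R \<V> ((\<xi>, \<mu>), t)) \<le> ereal (\<mu> + r * t))}"

definition gen_deriv ::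
  "'x::real_normed_vector set \<Rightarrow> ('x \<Rightarrow> ereal) \<Rightarrow> 'x \<Rightarrow> 'x \<Rightarrow> ereal" where
  "gen_deriv Y f u v = (SUP \<epsilon>\<in>{0<..}. gen_deriv_eps Y f \<epsilon> u v)"

text \<open>Functionals on \<open>Y\<close> are represented by functions that are \<^const>\<open>undefined\<close> off \<open>Y\<close>.\<close>

definition dual_space :: "'x::real_normed_vector set \<Rightarrow> ('x \<Rightarrow> real) set" where
  "dual_space Y = {\<alpha> \<in> extensional Y.
     (\<forall>x\<in>Y. \<forall>y\<in>Y. \<alpha> (x + y) = \<alpha> x + \<alpha> y) \<and>
     (\<forall>c. \<forall>x\<in>Y. \<alpha> (c *\<^sub>R x) = c * \<alpha> x) \<and>
     continuous_on Y \<alpha>}"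

definition subdifferential ::
  "'x::real_normed_vector set \<Rightarrow> ('x \<Rightarrow> ereal) \<Rightarrow> 'x \<Rightarrow> ('x \<Rightarrow> real) set" where
  "subdifferential Y f u = {\<alpha> \<in> dual_space Y. \<forall>v\<in>Y. ereal (\<alpha> v) \<le> gen_deriv Y f u v}"

definition critical_point ::
  "'x::real_normed_vector set \<Rightarrow> ('x \<Rightarrow> ereal) \<Rightarrow> 'x \<Rightarrow> bool" where
  "critical_point Y f u \<longleftrightarrow> (\<lambda>v\<in>Y. 0) \<in> subdifferential Y f u"

end

theory Submission
  imports Defs "HOL-Probability.Probability_Measure"
begin

text \<open>Call \<open>v\<close> a descent direction at rate \<open>r\<close> if \<open>r\<close> is admissible in the infimum defining
  \<open>f\<degree>\<^sub>\<epsilon>(u; v)\<close>. Following one descent field after another shows that these directions form a convex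
  set, and invariance of \<open>f\<close> makes it stable under the action up to a uniform change of \<open>\<epsilon>\<close>. Since \<open>A v\<close>
  lies in the closed convex hull of the orbit of \<open>v\<close>, a rate \<open>r < 0\<close> for \<open>v\<close> (and all \<open>\<epsilon>\<close>) is also one
  for \<open>A v\<close>. If \<open>\<V>\<close> is a descent field around \<open>A v\<close>, then \<open>A \<circ> \<V>\<close> is one on \<open>Fix(G)\<close>: the slope hypothesis
  at \<open>\<zeta> = \<xi> + t A \<V>\<close>, \<open>z = \<V>\<close> costs only \<open>C t \<parallel>\<V> - A \<V>\<parallel>\<close>, which is small compared to \<open>\<bar>r\<bar> t\<close>. Hence the
  restriction of \<open>f\<close> would have negative derivative along \<open>A v\<close>.\<close>

section \<open>The Bochner integral\<close>

lemma (in finite_measure) simple_bochner_integrable_iff_simple_function: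
  "Bochner_Integration.simple_bochner_integrable M s \<longleftrightarrow> simple_function M s"
  by (auto simp: simple_bochner_integrable.simps)

text \<open>Integrate the triangle inequality for \<open>s - t\<close> through \<open>f\<close> and
  \<open>g\<close>, the total mass being 1. The constant \<open>c\<close> replaces
  \<open>norm (f x - g x)\<close>, whose measurability is not assumed.\<close>

lemma norm_simple_bochner_integral_diff_le:
  fixes f g :: "'a \<Rightarrow> 'b::real_normed_vector"
  assumes "prob_space M"
    and s: "simple_function M s" and t: "simple_function M t"
    and [measurable]: "(\<lambda>x. norm (f x - s x)) \<in> borel_measurable M"
      "(\<lambda>x. norm (g x - t x)) \<in> borel_measurable M"
    and fg: "\<And>x. x \<in> space M \<Longrightarrow> norm (f x - g x) \<le> c"
  shows "ennreal (norm (Bochner_Integration.simple_bochner_integral M s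
      - Bochner_Integration.simple_bochner_integral M t))
    \<le> (\<integral>\<^sup>+x. ennreal (norm (f x - s x)) \<partial>M) + (\<integral>\<^sup>+x. ennreal (norm (g x - t x)) \<partial>M) + ennreal c"
proof -
  interpret prob_space M by fact
  let ?I = "Bochner_Integration.simple_bochner_integral M"
  \<comment> \<open>\<open>ennreal\<close> truncates negative reals to 0, so
    \<open>c \<ge> 0\<close> is settled before sums are moved under it; a probability space has a
    point at which \<open>fg\<close> shows this.\<close>
  obtain x0 where "x0 \<in> space M" using not_empty by blast
  then have c: "c \<ge> 0" using fg[of x0] norm_ge_zero order_trans by blast
  have si: "Bochner_Integration.simple_bochner_integrable M s"
    "Bochner_Integration.simple_bochner_integrable M t"
    "Bochner_Integration.simple_bochner_integrable M (\<lambda>x. s x - t x)"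
    "Bochner_Integration.simple_bochner_integrable M (\<lambda>x. norm (s x - t x))"
    using s t by (auto simp: simple_bochner_integrable_iff_simple_function
        intro: simple_function_compose2[where h = "\<lambda>x y. norm (x - y)"]
          simple_function_compose2[where h = "\<lambda>x y. x - y"])
  have "norm (?I s - ?I t) \<le> ?I (\<lambda>x. norm (s x - t x))"
    using simple_bochner_integral_norm_bound[OF si(3)] simple_bochner_integral_diff[OF si(1,2)] by simp
  then have "ennreal (norm (?I s - ?I t)) \<le> (\<integral>\<^sup>+x. ennreal (norm (s x - t x)) \<partial>M)"
    using simple_bochner_integral_eq_nn_integral[OF si(4)] by (metis ennreal_leI norm_ge_zero)
  also have "\<dots> \<le> (\<integral>\<^sup>+x. ennreal (norm (f x - s x)) + ennreal (norm (g x - t x)) + ennreal c \<partial>M)"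
  proof (rule nn_integral_mono)
    fix x assume "x \<in> space M"
    have "norm (s x - t x) \<le> norm (f x - s x) + norm (g x - t x) + norm (f x - g x)"
      by norm
    with fg[OF \<open>x \<in> space M\<close>] have "norm (s x - t x) \<le> norm (f x - s x) + norm (g x - t x) + c"
      by linarith
    then show "ennreal (norm (s x - t x)) \<le> ennreal (norm (f x - s x)) + ennreal (norm (g x - t x)) + ennreal c"
      using c by (simp flip: ennreal_plus)
  qed
  also have "\<dots> = (\<integral>\<^sup>+x. ennreal (norm (f x - s x)) \<partial>M) + (\<integral>\<^sup>+x. ennreal (norm (g x - t x)) \<partial>M) + ennreal c"
    by (simp add: nn_integral_add emeasure_space_1)
  finally show ?thesis .
qed

text \<open>The previous bound passes to the limit along approximating sequences. Later estimates of
  integrals rest on it: uniqueness with \<open>c = 0\<close>, the Cauchy property, the Lipschitz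
  bound for averaging.\<close>

lemma bochner_integral_is_dist_le:
  fixes f g :: "'a \<Rightarrow> 'b::real_normed_vector"
  assumes M: "prob_space M" and f: "bochner_integral_is M f w" and g: "bochner_integral_is M g z"
    and fg: "\<And>x. x \<in> space M \<Longrightarrow> norm (f x - g x) \<le> c"
  shows "norm (w - z) \<le> c"
proof -
  interpret prob_space M by fact
  let ?I = "Bochner_Integration.simple_bochner_integral M"
  obtain x0 where "x0 \<in> space M" using not_empty by blast
  then have c: "c \<ge> 0" using fg[of x0] norm_ge_zero order_trans by blast
  obtain s where s: "\<And>i. simple_function M (s i)" "\<And>i. (\<lambda>x. norm (f x - s i x)) \<in> borel_measurable M"
      "(\<lambda>i. \<integral>\<^sup>+x. ennreal (norm (f x - s i x)) \<partial>M) \<longlonglongrightarrow> 0" "(\<lambda>i. ?I (s i)) \<longlonglongrightarrow> w"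
    using f by (auto simp: bochner_integral_is_def simple_bochner_integrable_iff_simple_function)
  obtain t where t: "\<And>i. simple_function M (t i)" "\<And>i. (\<lambda>x. norm (g x - t i x)) \<in> borel_measurable M"
      "(\<lambda>i. \<integral>\<^sup>+x. ennreal (norm (g x - t i x)) \<partial>M) \<longlonglongrightarrow> 0" "(\<lambda>i. ?I (t i)) \<longlonglongrightarrow> z"
    using g by (auto simp: bochner_integral_is_def simple_bochner_integrable_iff_simple_function)
  have "ennreal (norm (w - z)) \<le> 0 + 0 + ennreal c"
  proof (rule LIMSEQ_le)
    show "(\<lambda>i. ennreal (norm (?I (s i) - ?I (t i)))) \<longlonglongrightarrow> ennreal (norm (w - z))"
      by (intro tendsto_ennrealI tendsto_norm tendsto_diff s t)
    show "(\<lambda>i. (\<integral>\<^sup>+x. ennreal (norm (f x - s i x)) \<partial>M) + (\<integral>\<^sup>+x. ennreal (norm (g x - t i x)) \<partial>M)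
        + ennreal c) \<longlonglongrightarrow> 0 + 0 + ennreal c"
      by (intro tendsto_add s t tendsto_const)
    show "\<exists>N. \<forall>i\<ge>N. ennreal (norm (?I (s i) - ?I (t i))) \<le>
        (\<integral>\<^sup>+x. ennreal (norm (f x - s i x)) \<partial>M) + (\<integral>\<^sup>+x. ennreal (norm (g x - t i x)) \<partial>M) + ennreal c"
      using norm_simple_bochner_integral_diff_le[OF M s(1) t(1) s(2) t(2) fg] by blast
  qed
  then show ?thesis using c by simp
qed

lemma bochner_integral_is_unique:
  assumes "prob_space M" "bochner_integral_is M f w" "bochner_integral_is M f z"
  shows "w = z"
  using bochner_integral_is_dist_le[OF assms, of 0] by simp

lemma bochner_integral_is_simple:
  assumes "finite_measure M" "simple_function M s"
  shows "bochner_integral_is M s (Bochner_Integration.simple_bochner_integral M s)"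
  using assms unfolding bochner_integral_is_def
  by (intro exI[of _ "\<lambda>_. s"]) (auto simp: finite_measure.simple_bochner_integrable_iff_simple_function)

lemma bochner_integral_is_const:
  assumes "prob_space M"
  shows "bochner_integral_is M (\<lambda>x. c) c"
proof -
  interpret prob_space M by fact
  have "{x. x \<in> space M} = space M" by simp
  then have "Bochner_Integration.simple_bochner_integral M (\<lambda>x. c) = c"
    using not_empty by (simp add: Bochner_Integration.simple_bochner_integral_def prob_space image_constant_conv)
  then show ?thesis
    using bochner_integral_is_simple[OF finite_measure_axioms, of "\<lambda>x. c"] by simp
qed

text \<open>The integral is a finite sum of values weighted by the measures of the level sets, which
  partition the space, so the weights sum to 1.\<close>

lemma simple_bochner_integral_in_convex_hull:
  assumes "prob_space M" and s: "simple_function M s"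
  shows "Bochner_Integration.simple_bochner_integral M s \<in> convex hull (s ` space M)"
proof -
  interpret prob_space M by fact
  have fin: "finite (s ` space M)" using s by (rule simple_functionD)
  have "(\<Sum>y\<in>s ` space M. measure M {x \<in> space M. s x = y}) = measure M (\<Union>y\<in>s ` space M. {x \<in> space M. s x = y})"
  proof (rule finite_measure_finite_Union[symmetric, OF fin])
    have "{x \<in> space M. s x = y} \<in> sets M" for y
      using measurable_simple_function[OF s] by measurable
    then show "(\<lambda>y. {x \<in> space M. s x = y}) ` s ` space M \<subseteq> sets M" by blast
    show "disjoint_family_on (\<lambda>y. {x \<in> space M. s x = y}) (s ` space M)"
      by (auto simp: disjoint_family_on_def)
  qed
  also have "(\<Union>y\<in>s ` space M. {x \<in> space M. s x = y}) = space M" by auto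
  finally have "(\<Sum>y\<in>s ` space M. measure M {x \<in> space M. s x = y}) = 1"
    by (simp add: prob_space)
  then show ?thesis
    unfolding Bochner_Integration.simple_bochner_integral_def
    by (intro convex_sum fin) (auto intro: hull_inc)
qed

section \<open>Existence of the integral for functions with compact range\<close>

lemma borel_measurable_norm_diff_simple:
  fixes f s :: "'a \<Rightarrow> 'b::real_normed_vector"
  assumes f: "\<And>c. (\<lambda>x. norm (f x - c)) \<in> borel_measurable M" and s: "simple_function M s"
  shows "(\<lambda>x. norm (f x - s x)) \<in> borel_measurable M"
proof -
  have [measurable]: "s \<in> measurable M (count_space UNIV)" using s by (rule measurable_simple_function)
  have fin: "finite (s ` space M)" using s by (rule simple_functionD)
  have [measurable]: "{x \<in> space M. s x = y} \<in> sets M" for y by measurable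
  \<comment> \<open>On the level set where \<open>s\<close> equals \<open>y\<close> the error is
    \<open>norm (f x - y)\<close>, a distance to a fixed point and hence measurable; there are
    finitely many level sets.\<close>
  have "(\<lambda>x. \<Sum>y\<in>s ` space M. norm (f x - y) * indicator {x \<in> space M. s x = y} x) \<in> borel_measurable M"
    using f by (intro borel_measurable_sum borel_measurable_times) auto
  also have "?this \<longleftrightarrow> (\<lambda>x. norm (f x - s x)) \<in> borel_measurable M"
  proof (rule measurable_cong)
    fix x assume "x \<in> space M"
    then show "(\<Sum>y\<in>s ` space M. norm (f x - y) * indicator {x \<in> space M. s x = y} x) = norm (f x - s x)"
      using fin by (subst sum.remove[of _ "s x"]) (auto simp: indicator_def intro!: sum.neutral)
  qed
  finally show ?thesis .
qed

text \<open>Induction on the net: a point within \<open>e\<close> of the newly inserted centre is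
  sent there, all others keep their earlier value.\<close>

lemma simple_function_finite_net:
  fixes f :: "'a \<Rightarrow> 'b::real_normed_vector"
  assumes f: "\<And>c. (\<lambda>x. norm (f x - c)) \<in> borel_measurable M" and "finite K"
  shows "\<exists>s. simple_function M s \<and>
    (\<forall>x\<in>space M. f x \<in> (\<Union>c\<in>K. ball c e) \<longrightarrow> s x \<in> K \<and> norm (f x - s x) < e)"
  using \<open>finite K\<close>
proof induction
  case empty
  \<comment> \<open>Outside the balls the value is the default 0, harmless since the bound is
    claimed only inside them.\<close>
  have "simple_function M (\<lambda>x. 0)" by simp
  then show ?case by blast
next
  case (insert c K)
  then obtain s where s: "simple_function M s"
    "\<And>x. x \<in> space M \<Longrightarrow> f x \<in> (\<Union>c\<in>K. ball c e) \<Longrightarrow> s x \<in> K \<and> norm (f x - s x) < e" by blast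
  have [measurable]: "(\<lambda>x. norm (f x - c)) \<in> borel_measurable M" by (rule f)
  have "simple_function M (\<lambda>x. if norm (f x - c) < e then c else s x)"
    by (intro simple_function_If simple_function_const s) measurable
  moreover have "f x \<in> ball c e \<longleftrightarrow> norm (f x - c) < e" for x
    by (simp add: dist_norm norm_minus_commute)
  ultimately show ?case using s(2)
    by (intro exI[of _ "\<lambda>x. if norm (f x - c) < e then c else s x"]) auto
qed

text \<open>Compactness gives a finite net inside the range. Taking its points as values keeps
  \<open>s\<close> in the range of \<open>f\<close>, which for an orbit later yields convex
  combinations of orbit points.\<close>

lemma simple_function_approx:
  fixes f :: "'a \<Rightarrow> 'b::real_normed_vector"
  assumes f: "\<And>c. (\<lambda>x. norm (f x - c)) \<in> borel_measurable M" and "compact (f ` space M)" and "e > 0"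
  obtains s where "simple_function M s" "s ` space M \<subseteq> f ` space M"
    "\<And>x. x \<in> space M \<Longrightarrow> norm (f x - s x) < e"
proof -
  have "seq_compact (f ` space M)" using assms(2) by (simp add: compact_eq_seq_compact_metric)
  from seq_compact_imp_totally_bounded[OF this, rule_format, OF \<open>e > 0\<close>]
  obtain K where K: "finite K" "K \<subseteq> f ` space M" "f ` space M \<subseteq> (\<Union>c\<in>K. ball c e)"
    by blast
  from simple_function_finite_net[of f M K e, OF f K(1)] obtain s where s: "simple_function M s"
    "\<And>x. x \<in> space M \<Longrightarrow> f x \<in> (\<Union>c\<in>K. ball c e) \<Longrightarrow> s x \<in> K \<and> norm (f x - s x) < e" by blast
  have "s x \<in> K \<and> norm (f x - s x) < e" if "x \<in> space M" for x
    using s(2)[OF that] K(3) that by (meson imageI subsetD)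
  with K s(1) show ?thesis by (intro that[of s]) auto
qed

text \<open>Uniform approximation by simple functions makes their integrals Cauchy, and completeness
  of the space supplies the limit. On a space of mass 1 the integrated errors obey the same uniform
  bound.\<close>

lemma bochner_integral_is_exists:
  fixes f :: "'a \<Rightarrow> 'b::banach"
  assumes "prob_space M" and f: "\<And>c. (\<lambda>x. norm (f x - c)) \<in> borel_measurable M"
    and "compact (f ` space M)"
  shows "\<exists>w. bochner_integral_is M f w"
proof -
  interpret prob_space M by fact
  let ?I = "Bochner_Integration.simple_bochner_integral M"
  have "\<exists>s. simple_function M s \<and> (\<forall>x\<in>space M. norm (f x - s x) < inverse (Suc i))" for i :: nat
    by (rule simple_function_approx[of f M, OF f assms(3), of "inverse (Suc i)"]) auto
  then obtain s where s: "\<And>i. simple_function M (s i)"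
    and err: "\<And>i x. x \<in> space M \<Longrightarrow> norm (f x - s i x) < inverse (real (Suc i))" by metis
  have dist: "norm (?I (s i) - ?I (s j)) \<le> inverse (Suc i) + inverse (Suc j)" for i j
  proof (rule bochner_integral_is_dist_le[OF prob_space_axioms
        bochner_integral_is_simple[OF finite_measure_axioms s] bochner_integral_is_simple[OF finite_measure_axioms s]])
    fix x assume "x \<in> space M"
    then show "norm (s i x - s j x) \<le> inverse (Suc i) + inverse (Suc j)"
      using err[of x i] err[of x j] norm_triangle_ineq4[of "f x - s j x" "f x - s i x"] by simp
  qed
  have "Cauchy (\<lambda>i. ?I (s i))"
  proof (rule CauchyI)
    fix e :: real assume "e > 0"
    then obtain N where N: "inverse (Suc N) < e / 2" using reals_Archimedean[of "e / 2"] by auto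
    have "norm (?I (s i) - ?I (s j)) < e" if "i \<ge> N" "j \<ge> N" for i j
    proof -
      have "inverse (Suc i) \<le> inverse (Suc N)" "inverse (Suc j) \<le> inverse (Suc N)"
        using that by (auto intro!: le_imp_inverse_le)
      then show ?thesis using dist[of i j] N by linarith
    qed
    then show "\<exists>N. \<forall>i\<ge>N. \<forall>j\<ge>N. norm (?I (s i) - ?I (s j)) < e" by blast
  qed
  then obtain w where w: "(\<lambda>i. ?I (s i)) \<longlonglongrightarrow> w" using Cauchy_convergent convergent_def by blast
  have "(\<lambda>i. \<integral>\<^sup>+x. ennreal (norm (f x - s i x)) \<partial>M) \<longlonglongrightarrow> 0"
  proof (rule tendsto_sandwich[of "\<lambda>_. 0" _ _ "\<lambda>i. ennreal (inverse (real (Suc i)))"])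
    have "(\<integral>\<^sup>+x. ennreal (norm (f x - s i x)) \<partial>M) \<le> (\<integral>\<^sup>+x. ennreal (inverse (real (Suc i))) \<partial>M)" for i
      by (intro nn_integral_mono ennreal_leI less_imp_le err)
    then show "\<forall>\<^sub>F i in sequentially. (\<integral>\<^sup>+x. ennreal (norm (f x - s i x)) \<partial>M) \<le> ennreal (inverse (real (Suc i)))"
      by (simp add: emeasure_space_1)
    show "(\<lambda>i. ennreal (inverse (real (Suc i)))) \<longlonglongrightarrow> 0"
      using tendsto_ennrealI[OF LIMSEQ_inverse_real_of_nat] by simp
  qed auto
  with w s borel_measurable_norm_diff_simple[of f, OF f s] show ?thesis
    unfolding bochner_integral_is_def
    by (auto simp: simple_bochner_integrable_iff_simple_function)
qed

section \<open>Averaging over a compact group\<close>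

locale compact_group_linear_action = group G for G :: "('g, 'm) monoid_scheme" (structure) +
  fixes T :: "'g topology" and \<mu> :: "'g measure" and \<phi> :: "'g \<Rightarrow> 'x \<Rightarrow> 'x::banach"
  assumes topspace_eq: "topspace T = carrier G"
    and compact: "compact_space T"
    and continuous_mult: "continuous_map (prod_topology T T) T (\<lambda>(x, y). x \<otimes> y)"
    and acts: "acts_linearly G T \<phi>"
    and haar: "normalized_haar_measure G T \<mu>"
begin

section \<open>Algebra of the action and its uniform bound\<close>

lemma action: "group_action G UNIV \<phi>"
  using acts by (simp add: acts_linearly_def)

lemma linear_action: "g \<in> carrier G \<Longrightarrow> linear (\<phi> g)"
  using acts by (simp add: acts_linearly_def)

lemma action_mult: "g \<in> carrier G \<Longrightarrow> h \<in> carrier G \<Longrightarrow> \<phi> (g \<otimes> h) x = \<phi> g (\<phi> h x)"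
  by (rule group_action.composition_rule[OF action UNIV_I])

lemma action_inv: "g \<in> carrier G \<Longrightarrow> \<phi> g (\<phi> (inv g) x) = x"
  using action_mult[of g "inv g" x] group_action.id_eq_one[OF action, symmetric] by simp

lemma inj_action: "g \<in> carrier G \<Longrightarrow> inj (\<phi> g)"
  by (rule group_action.inj_prop[OF action])

lemma continuous_map_action: "continuous_map T euclidean (\<lambda>g. \<phi> g v)"
proof -
  have "continuous_map (prod_topology T euclidean) euclidean (\<lambda>(g, u). \<phi> g u)"
    using acts by (simp add: acts_linearly_def)
  from continuous_map_compose[OF _ this, of T "\<lambda>g. (g, v)"] show ?thesis
    by (simp add: continuous_map_pairedI o_def)
qed

text \<open>By continuity at the points \<open>(g, 0)\<close> and compactness of the group, the tube
  lemma gives one ball around 0 that every \<open>g\<close> maps into the unit ball; homogeneity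
  turns this into an operator bound.\<close>

lemma action_bound:
  obtains B where "B > 0" "\<And>g x. g \<in> carrier G \<Longrightarrow> norm (\<phi> g x) \<le> B * norm x"
proof -
  have cont: "continuous_map (prod_topology T euclidean) euclidean (\<lambda>(g, u). \<phi> g u)"
    using acts by (simp add: acts_linearly_def)
  let ?W = "{p \<in> topspace (prod_topology T euclidean). (\<lambda>(g, u). \<phi> g u) p \<in> ball 0 1}"
  obtain U V where U: "openin T U" "openin euclidean V" "topspace T \<subseteq> U" "{0} \<subseteq> V" "U \<times> V \<subseteq> ?W"
  proof (rule Wallace_theorem_prod_topology)
    show "compactin T (topspace T)" using compact by (simp add: compact_space_def)
    show "compactin euclidean {0::'x}" by simp
    show "openin (prod_topology T euclidean) ?W"
      by (rule openin_continuous_map_preimage[OF cont]) simp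
    show "topspace T \<times> {0} \<subseteq> ?W"
      by (auto simp: topspace_eq linear_0[OF linear_action])
  qed
  then obtain d where d: "d > 0" "ball 0 d \<subseteq> V"
    by (metis openE insert_subset open_openin)
  have "norm (\<phi> g x) \<le> 2 / d * norm x" if g: "g \<in> carrier G" for g x
  proof (cases "x = 0")
    case True then show ?thesis using linear_0[OF linear_action[OF g]] by simp
  next
    case False
    \<comment> \<open>Rescaled to norm \<open>d / 2\<close>, inside the ball of radius
      \<open>d\<close>; hence the constant \<open>2 / d\<close>.\<close>
    let ?y = "(d / (2 * norm x)) *\<^sub>R x"
    have "?y \<in> ball 0 d" using False d by simp
    then have "(g, ?y) \<in> U \<times> V" using d U g topspace_eq by auto
    then have "norm (\<phi> g ?y) < 1" using U by auto
    then have "(d / (2 * norm x)) * norm (\<phi> g x) < 1"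
      using linear_cmul[OF linear_action[OF g]] d by simp
    then show ?thesis using False d by (simp add: field_simps)
  qed
  with d show ?thesis by (intro that[of "2 / d"]) auto
qed

lemma bounded_linear_action:
  assumes "g \<in> carrier G"
  shows "bounded_linear (\<phi> g)"
proof -
  obtain B where "\<And>x. norm (\<phi> g x) \<le> B * norm x"
    using action_bound assms by metis
  then show ?thesis
    using linear_action[OF assms]
    by (intro bounded_linear_intro[of _ B]) (auto simp: linear_add linear_cmul mult.commute)
qed

lemma subspace_Fix_set: "subspace (Fix_set G \<phi>)"
  unfolding subspace_def Fix_set_def
  by (auto simp: linear_0 linear_add linear_cmul linear_action)

section \<open>Haar measure and measurability of orbit maps\<close>

lemma space_haar: "space \<mu> = carrier G"
  and sets_haar: "sets \<mu> = sigma_sets (carrier G) {U. openin T U}"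
proof -
  show "sets \<mu> = sigma_sets (carrier G) {U. openin T U}"
    using haar by (simp add: normalized_haar_measure_def topspace_eq)
  also have "\<dots> = sets (sigma (carrier G) {U. openin T U})"
    using openin_subset[of T] topspace_eq by (intro sets_measure_of[symmetric]) auto
  \<comment> \<open>\<open>normalized_haar_measure\<close> prescribes only the sets of
    \<open>\<mu>\<close>; its space is recovered because a sigma-algebra determines it.\<close>
  finally show "space \<mu> = carrier G"
    using openin_subset[of T] topspace_eq by (auto dest!: sets_eq_imp_space_eq simp: space_measure_of_conv)
qed

lemma prob_space_haar: "prob_space \<mu>"
  using haar by (intro prob_spaceI) (simp add: normalized_haar_measure_def topspace_eq space_haar)

lemma measurable_haar:
  assumes "\<And>U. open U \<Longrightarrow> openin T {x \<in> topspace T. f x \<in> U}"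
  shows "f \<in> borel_measurable \<mu>"
proof (rule borel_measurableI)
  fix U :: "'a set" assume "open U"
  then show "f -` U \<inter> space \<mu> \<in> sets \<mu>" using assms[of U]
    by (auto simp: sets_haar space_haar topspace_eq vimage_def Int_def conj_commute intro!: sigma_sets.Basic)
qed

lemma measurable_norm_action_diff: "(\<lambda>g. norm (\<phi> g v - c)) \<in> borel_measurable \<mu>"
proof (rule measurable_haar)
  fix U :: "real set" assume U: "open U"
  have "continuous_map T euclidean (\<lambda>g. norm (\<phi> g v - c))"
    using continuous_map_compose[OF continuous_map_action, of euclidean "\<lambda>x. norm (x - c)" v]
    by (simp add: o_def continuous_on_norm continuous_on_diff)
  then show "openin T {g \<in> topspace T. norm (\<phi> g v - c) \<in> U}"
    by (rule openin_continuous_map_preimage) (use U in simp)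
qed

lemma compact_orbit: "compact ((\<lambda>g. \<phi> g v) ` space \<mu>)"
  using image_compactin[OF _ continuous_map_action, of "topspace T" v] compact
  by (simp add: compact_space_def space_haar topspace_eq)

section \<open>The averaging map: hull membership, continuity and fixed points\<close>

lemma averaging_map: "bochner_integral_is \<mu> (\<lambda>g. \<phi> g v) (averaging_map \<mu> \<phi> v)"
proof -
  obtain w where "bochner_integral_is \<mu> (\<lambda>g. \<phi> g v) w"
    using bochner_integral_is_exists[OF prob_space_haar, of "\<lambda>g. \<phi> g v"]
      measurable_norm_action_diff compact_orbit by blast
  then show ?thesis
    unfolding averaging_map_def using bochner_integral_is_unique[OF prob_space_haar] by (metis theI)
qed

text \<open>Such simple functions serve two purposes below: values in the orbit give membership in
  the closed convex hull, and the uniform error gives invariance of the average.\<close>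

lemma simple_function_action_approx:
  assumes "e > 0"
  obtains s where "simple_function \<mu> s" "s ` space \<mu> \<subseteq> (\<lambda>g. \<phi> g v) ` carrier G"
    "\<forall>g\<in>carrier G. norm (\<phi> g v - s g) < e"
    "norm (averaging_map \<mu> \<phi> v - Bochner_Integration.simple_bochner_integral \<mu> s) \<le> e"
proof -
  obtain s where s: "simple_function \<mu> s" "s ` space \<mu> \<subseteq> (\<lambda>g. \<phi> g v) ` space \<mu>"
    "\<And>g. g \<in> space \<mu> \<Longrightarrow> norm (\<phi> g v - s g) < e"
    using simple_function_approx[of "\<lambda>g. \<phi> g v" \<mu> e, OF measurable_norm_action_diff compact_orbit assms] by blast
  have "norm (averaging_map \<mu> \<phi> v - Bochner_Integration.simple_bochner_integral \<mu> s) \<le> e"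
    by (rule bochner_integral_is_dist_le[OF prob_space_haar averaging_map bochner_integral_is_simple])
       (use s prob_space_haar in \<open>auto simp: prob_space_def intro: less_imp_le\<close>)
  with s show ?thesis by (intro that) (auto simp: space_haar)
qed

text \<open>The integrals of the simple approximants are convex combinations of orbit points,
  arbitrarily close to the average.\<close>

lemma averaging_map_in_closure_convex_hull:
  "averaging_map \<mu> \<phi> v \<in> closure (convex hull ((\<lambda>g. \<phi> g v) ` carrier G))"
  unfolding closure_approachable
proof (intro allI impI)
  fix e :: real assume "e > 0"
  then have "e / 2 > 0" by simp
  then obtain s where s: "simple_function \<mu> s" "s ` space \<mu> \<subseteq> (\<lambda>g. \<phi> g v) ` carrier G"
    "\<forall>g\<in>carrier G. norm (\<phi> g v - s g) < e / 2"
    "norm (averaging_map \<mu> \<phi> v - Bochner_Integration.simple_bochner_integral \<mu> s) \<le> e / 2"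
    by (rule simple_function_action_approx[where v = v])
  have "Bochner_Integration.simple_bochner_integral \<mu> s \<in> convex hull ((\<lambda>g. \<phi> g v) ` carrier G)"
    using simple_bochner_integral_in_convex_hull[OF prob_space_haar s(1)] hull_mono[OF s(2)] by blast
  with s(4) \<open>e > 0\<close> show "\<exists>y\<in>convex hull ((\<lambda>g. \<phi> g v) ` carrier G). dist y (averaging_map \<mu> \<phi> v) < e"
    by (intro bexI[of _ "Bochner_Integration.simple_bochner_integral \<mu> s"]) (auto simp: dist_norm norm_minus_commute)
qed

lemma averaging_map_of_Fix_set:
  assumes "v \<in> Fix_set G \<phi>"
  shows "averaging_map \<mu> \<phi> v = v"
proof -
  have "norm (averaging_map \<mu> \<phi> v - v) \<le> 0"
    by (rule bochner_integral_is_dist_le[OF prob_space_haar averaging_map bochner_integral_is_const[OF prob_space_haar]])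
       (use assms in \<open>auto simp: Fix_set_def space_haar\<close>)
  then show ?thesis by simp
qed

text \<open>The uniform bound \<open>B\<close> on the action, applied to \<open>v - w\<close> under
  the integral, is a Lipschitz constant.\<close>

lemma continuous_on_averaging_map: "continuous_on UNIV (averaging_map \<mu> \<phi>)"
proof -
  obtain B where B: "B > 0" "\<And>g x. g \<in> carrier G \<Longrightarrow> norm (\<phi> g x) \<le> B * norm x"
    using action_bound by blast
  have "norm (averaging_map \<mu> \<phi> v - averaging_map \<mu> \<phi> w) \<le> B * norm (v - w)" for v w
    by (rule bochner_integral_is_dist_le[OF prob_space_haar averaging_map averaging_map])
       (use B in \<open>auto simp: space_haar simp flip: linear_diff[OF linear_action]\<close>)
  then have "B-lipschitz_on UNIV (averaging_map \<mu> \<phi>)"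
    using B(1) by (auto simp: lipschitz_on_def dist_norm)
  then show ?thesis by (rule lipschitz_on_continuous_on)
qed

lemma measurable_left_translation:
  assumes h: "h \<in> carrier G"
  shows "(\<lambda>x. h \<otimes> x) \<in> measurable \<mu> \<mu>"
proof (rule measurable_sigma_sets[OF sets_haar])
  show "{U. openin T U} \<subseteq> Pow (carrier G)" using openin_subset[of T] topspace_eq by auto
  show "(\<lambda>x. h \<otimes> x) \<in> space \<mu> \<rightarrow> carrier G" using h by (auto simp: space_haar)
  fix U assume "U \<in> {U. openin T U}"
  have "continuous_map T T (\<lambda>x. h \<otimes> x)"
    using continuous_map_compose[OF _ continuous_mult, of T "\<lambda>x. (h, x)"] h
    by (simp add: continuous_map_pairedI o_def topspace_eq)
  then have "openin T {x \<in> topspace T. h \<otimes> x \<in> U}"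
    using \<open>U \<in> _\<close> by (intro openin_continuous_map_preimage) auto
  then show "(\<lambda>x. h \<otimes> x) -` U \<inter> space \<mu> \<in> sets \<mu>"
    by (auto simp: sets_haar space_haar topspace_eq vimage_def Int_def conj_commute intro!: sigma_sets.Basic)
qed

text \<open>Left invariance is used on simple functions: \<open>?a\<close> and
  \<open>\<phi> h ?a\<close> are both within \<open>e / 2\<close> of the integral of one translated
  simple function, for every \<open>e > 0\<close>.\<close>

lemma averaging_map_in_Fix_set: "averaging_map \<mu> \<phi> v \<in> Fix_set G \<phi>"
  unfolding Fix_set_def
proof safe
  fix h assume h: "h \<in> carrier G"
  let ?a = "averaging_map \<mu> \<phi> v"
  let ?I = "Bochner_Integration.simple_bochner_integral \<mu>"
  interpret prob_space \<mu> by (rule prob_space_haar)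
  obtain B where B: "B > 0" "\<And>g x. g \<in> carrier G \<Longrightarrow> norm (\<phi> g x) \<le> B * norm x"
    using action_bound by blast
  have "norm (?a - \<phi> h ?a) \<le> e" if "e > 0" for e
  proof -
    \<comment> \<open>Applying \<open>\<phi> h\<close> magnifies errors by at most \<open>B\<close>,
      so this tolerance leaves \<open>e / 2\<close> for each of the two comparisons.\<close>
    have "e / (2 * B) > 0" using that B by simp
    then obtain s where s: "simple_function \<mu> s" and "s ` space \<mu> \<subseteq> (\<lambda>g. \<phi> g v) ` carrier G"
      and err: "\<forall>g\<in>carrier G. norm (\<phi> g v - s g) < e / (2 * B)"
      and int: "norm (?a - ?I s) \<le> e / (2 * B)"
      by (rule simple_function_action_approx[where v = v])
    \<comment> \<open>\<open>t\<close> approximates the same integrand as \<open>s\<close>, since \<open>\<phi> h (\<phi> (inv h \<otimes> g) v) = \<phi> g v\<close>, and its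
      integral is \<open>\<phi> h\<close> applied to that of \<open>s\<close> by left invariance.\<close>
    define t where "t g = \<phi> h (s (inv h \<otimes> g))" for g
    have t: "simple_function \<mu> t"
      unfolding t_def
      using simple_function_comp[OF measurable_left_translation[of "inv h"] s] h
      by (auto intro: simple_function_compose1[where g = "\<phi> h"])
    \<comment> \<open>As \<open>\<phi> h\<close> is injective, the level set of \<open>t\<close> at
      \<open>\<phi> h y\<close> is the left translate by \<open>h\<close> of that of
      \<open>s\<close> at \<open>y\<close>, so invariance of the measure applies.\<close>
    have translate: "measure \<mu> {x \<in> space \<mu>. t x = \<phi> h y} = measure \<mu> {x \<in> space \<mu>. s x = y}" for y
    proof -
      have "{x \<in> space \<mu>. t x = \<phi> h y} = (\<lambda>x. h \<otimes> x) ` {x \<in> space \<mu>. s x = y}"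
      proof safe
        fix x assume "x \<in> space \<mu>" "t x = \<phi> h y"
        then show "x \<in> (\<lambda>x. h \<otimes> x) ` {x \<in> space \<mu>. s x = y}" using h injD[OF inj_action[OF h]]
          by (intro image_eqI[of _ _ "inv h \<otimes> x"]) (auto simp: t_def space_haar m_assoc[symmetric])
      qed (use h in \<open>auto simp: t_def space_haar m_assoc[symmetric]\<close>)
      moreover have "{x \<in> space \<mu>. s x = y} \<in> sets \<mu>"
        using measurable_simple_function[OF s] by measurable
      ultimately show ?thesis
        using haar h by (simp add: normalized_haar_measure_def measure_def)
    qed
    have "t ` space \<mu> = \<phi> h ` s ` space \<mu>"
    proof safe
      fix x assume "x \<in> space \<mu>"
      then have "h \<otimes> x \<in> space \<mu>" "t (h \<otimes> x) = \<phi> h (s x)"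
        using h by (auto simp: t_def space_haar m_assoc[symmetric])
      then show "\<phi> h (s x) \<in> t ` space \<mu>" by (metis imageI)
    qed (use h in \<open>auto simp: t_def space_haar\<close>)
    then have "?I t = (\<Sum>y\<in>s ` space \<mu>. measure \<mu> {x \<in> space \<mu>. s x = y} *\<^sub>R \<phi> h y)"
      using inj_action[OF h] translate
      by (simp add: Bochner_Integration.simple_bochner_integral_def sum.reindex inj_on_subset)
    also have "\<dots> = \<phi> h (?I s)"
      by (simp add: Bochner_Integration.simple_bochner_integral_def linear_sum[OF linear_action[OF h]]
          linear_cmul[OF linear_action[OF h]])
    finally have It: "?I t = \<phi> h (?I s)" .
    have "norm (?a - ?I t) \<le> e / 2"
    proof (rule bochner_integral_is_dist_le[OF prob_space_axioms averaging_map
          bochner_integral_is_simple[OF finite_measure_axioms t]])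
      fix g assume "g \<in> space \<mu>"
      then have g: "g \<in> carrier G" "inv h \<otimes> g \<in> carrier G" using h by (auto simp: space_haar)
      then have "\<phi> g v = \<phi> h (\<phi> (inv h \<otimes> g) v)"
        using h by (simp add: action_mult action_inv)
      then have "\<phi> g v - t g = \<phi> h (\<phi> (inv h \<otimes> g) v - s (inv h \<otimes> g))"
        by (simp add: t_def linear_diff[OF linear_action[OF h]])
      then have "norm (\<phi> g v - t g) \<le> B * norm (\<phi> (inv h \<otimes> g) v - s (inv h \<otimes> g))"
        using B(2)[OF h] by simp
      also have "\<dots> \<le> B * (e / (2 * B))" using bspec[OF err g(2)] B(1) by (intro mult_left_mono) auto
      finally show "norm (\<phi> g v - t g) \<le> e / 2" using B(1) by simp
    qed
    moreover have "norm (\<phi> h (?I s - ?a)) \<le> B * (e / (2 * B))"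
      using B(2)[OF h, of "?I s - ?a"] int B(1)
      by (smt (verit) mult_left_mono norm_minus_commute)
    then have "norm (?I t - \<phi> h ?a) \<le> e / 2"
      using B(1) by (simp add: It linear_diff[OF linear_action[OF h]])
    ultimately show ?thesis by norm
  qed
  then have "norm (?a - \<phi> h ?a) \<le> 0" by (meson field_le_epsilon add_0 order_refl dense_ge)
  then show "\<phi> h ?a = ?a" by simp
qed

end

section \<open>Descent directions\<close>

abbreviation epi_ball :: "'x::real_normed_vector set \<Rightarrow> ('x \<Rightarrow> ereal) \<Rightarrow> 'x \<Rightarrow> real \<Rightarrow> ('x \<times> real) set" where
  "epi_ball Y f u \<delta> \<equiv> ball (u, real_of_ereal (f u)) \<delta> \<inter> epi Y f"

text \<open>The condition on a rate inside \<open>gen_deriv_eps\<close>, with its witnesses as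
  arguments so that fields can be rescaled, composed and transported.\<close>

definition descent_field ::
  "'x::real_normed_vector set \<Rightarrow> ('x \<Rightarrow> ereal) \<Rightarrow> 'x \<Rightarrow> real \<Rightarrow> real \<Rightarrow> 'x \<Rightarrow> real \<Rightarrow> (('x \<times> real) \<times> real \<Rightarrow> 'x) \<Rightarrow> bool"
  where
  "descent_field Y f u \<epsilon> r v \<delta> \<V> \<longleftrightarrow> \<delta> > 0 \<and> continuous_on (epi_ball Y f u \<delta> \<times> {0<..\<delta>}) \<V> \<and>
     (\<forall>\<xi> \<mu> t. (\<xi>, \<mu>) \<in> epi_ball Y f u \<delta> \<longrightarrow> 0 < t \<longrightarrow> t \<le> \<delta> \<longrightarrow>
        \<V> ((\<xi>, \<mu>), t) \<in> Y \<and> dist v (\<V> ((\<xi>, \<mu>), t)) < \<epsilon> \<and>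
        f (\<xi> + t *\<^sub>R \<V> ((\<xi>, \<mu>), t)) \<le> ereal (\<mu> + r * t))"

definition descent_directions ::
  "'x::real_normed_vector set \<Rightarrow> ('x \<Rightarrow> ereal) \<Rightarrow> 'x \<Rightarrow> real \<Rightarrow> real \<Rightarrow> 'x set" where
  "descent_directions Y f u \<epsilon> r = {v. \<exists>\<delta> \<V>. descent_field Y f u \<epsilon> r v \<delta> \<V>}"

lemma gen_deriv_eps_eq: "gen_deriv_eps Y f \<epsilon> u v = Inf {ereal r | r. v \<in> descent_directions Y f u \<epsilon> r}"
proof -
  have "descent_field Y f u \<epsilon> r v = (\<lambda>\<delta> \<V>. \<delta> > 0 \<and> (let N = epi_ball Y f u \<delta> in
         continuous_on (N \<times> {0<..\<delta>}) \<V> \<and>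
         \<V> ` (N \<times> {0<..\<delta>}) \<subseteq> ball v \<epsilon> \<inter> Y \<and>
         (\<forall>(\<xi>, \<mu>)\<in>N. \<forall>t\<in>{0<..\<delta>}. f (\<xi> + t *\<^sub>R \<V> ((\<xi>, \<mu>), t)) \<le> ereal (\<mu> + r * t))))" for r
    unfolding fun_eq_iff descent_field_def Let_def Ball_def image_subset_iff
    by (simp only: split_paired_All mem_Times_iff fst_conv snd_conv case_prod_conv
        greaterThanAtMost_iff mem_ball Int_iff) blast
  then show ?thesis
    by (simp only: gen_deriv_eps_def descent_directions_def mem_Collect_eq ex_simps)
qed

lemma descent_fieldI:
  assumes "\<delta> > 0" "continuous_on (epi_ball Y f u \<delta> \<times> {0<..\<delta>}) \<V>"
    and "\<And>\<xi> \<mu> t. (\<xi>, \<mu>) \<in> epi_ball Y f u \<delta> \<Longrightarrow> 0 < t \<Longrightarrow> t \<le> \<delta>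
      \<Longrightarrow> \<V> ((\<xi>, \<mu>), t) \<in> Y \<and> dist v (\<V> ((\<xi>, \<mu>), t)) < \<epsilon> \<and>
          f (\<xi> + t *\<^sub>R \<V> ((\<xi>, \<mu>), t)) \<le> ereal (\<mu> + r * t)"
  shows "descent_field Y f u \<epsilon> r v \<delta> \<V>"
  using assms by (simp add: descent_field_def)

lemma descent_fieldD:
  assumes "descent_field Y f u \<epsilon> r v \<delta> \<V>"
  shows "\<delta> > 0" "continuous_on (epi_ball Y f u \<delta> \<times> {0<..\<delta>}) \<V>"
    "\<And>\<xi> \<mu> t. (\<xi>, \<mu>) \<in> epi_ball Y f u \<delta> \<Longrightarrow> 0 < t \<Longrightarrow> t \<le> \<delta> \<Longrightarrow> \<V> ((\<xi>, \<mu>), t) \<in> Y"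
    "\<And>\<xi> \<mu> t. (\<xi>, \<mu>) \<in> epi_ball Y f u \<delta> \<Longrightarrow> 0 < t \<Longrightarrow> t \<le> \<delta> \<Longrightarrow> dist v (\<V> ((\<xi>, \<mu>), t)) < \<epsilon>"
    "\<And>\<xi> \<mu> t. (\<xi>, \<mu>) \<in> epi_ball Y f u \<delta> \<Longrightarrow> 0 < t \<Longrightarrow> t \<le> \<delta> \<Longrightarrow>
       f (\<xi> + t *\<^sub>R \<V> ((\<xi>, \<mu>), t)) \<le> ereal (\<mu> + r * t)"
  using assms by (simp_all add: descent_field_def)

section \<open>Convexity and stability of descent directions\<close>

lemma descent_field_scaleR:
  assumes "subspace Y" and V: "descent_field Y f u \<epsilon> r v \<delta> \<V>" and "a > 0"
  shows "descent_field Y f u (a * \<epsilon>) (a * r) (a *\<^sub>R v) (min \<delta> (\<delta> / a)) (\<lambda>(x, t). a *\<^sub>R \<V> (x, a * t))"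
proof -
  note V = descent_fieldD[OF V]
  \<comment> \<open>Time \<open>t\<close> along the rescaled field is time \<open>a * t\<close>
    along \<open>\<V>\<close>, which must stay at most \<open>\<delta>\<close>;
    \<open>\<eta> \<le> \<delta>\<close> keeps the base points in the domain of
    \<open>\<V>\<close>.\<close>
  define \<eta> where "\<eta> = min \<delta> (\<delta> / a)"
  have \<eta>: "\<eta> > 0" "\<eta> \<le> \<delta>" and \<eta>': "\<And>t. t \<le> \<eta> \<Longrightarrow> a * t \<le> \<delta>"
    using V(1) \<open>a > 0\<close> by (auto simp: \<eta>_def field_simps)
  show ?thesis unfolding \<eta>_def[symmetric]
  proof (rule descent_fieldI[OF \<eta>(1)])
    show "continuous_on (epi_ball Y f u \<eta> \<times> {0<..\<eta>}) (\<lambda>(x, t). a *\<^sub>R \<V> (x, a * t))"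
      unfolding case_prod_unfold
      by (intro continuous_on_scaleR continuous_on_compose2[OF V(2)] continuous_intros)
         (use \<eta> \<eta>' \<open>a > 0\<close> in auto)
    fix \<xi> \<mu> t
    assume a: "(\<xi>, \<mu>) \<in> epi_ball Y f u \<eta>" "0 < t" "t \<le> \<eta>"
    have b: "(\<xi>, \<mu>) \<in> epi_ball Y f u \<delta>" "0 < a * t" "a * t \<le> \<delta>"
      using a \<eta> \<eta>' \<open>a > 0\<close> by auto
    have "dist (a *\<^sub>R v) (a *\<^sub>R \<V> ((\<xi>, \<mu>), a * t)) < a * \<epsilon>"
      using V(4)[OF b] \<open>a > 0\<close> by (simp add: dist_norm flip: scaleR_diff_right)
    with V(3,5)[OF b] \<open>subspace Y\<close>
    show "(case ((\<xi>, \<mu>), t) of (x, t) \<Rightarrow> a *\<^sub>R \<V> (x, a * t)) \<in> Y \<and>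
        dist (a *\<^sub>R v) (case ((\<xi>, \<mu>), t) of (x, t) \<Rightarrow> a *\<^sub>R \<V> (x, a * t)) < a * \<epsilon> \<and>
        f (\<xi> + t *\<^sub>R (case ((\<xi>, \<mu>), t) of (x, t) \<Rightarrow> a *\<^sub>R \<V> (x, a * t))) \<le> ereal (\<mu> + a * r * t)"
      by (simp add: subspace_scale mult.commute mult.left_commute)
  qed
qed

lemma descent_directions_scaleR:
  assumes "subspace Y" and "v \<in> descent_directions Y f u \<epsilon> r" and "a > 0"
  shows "a *\<^sub>R v \<in> descent_directions Y f u (a * \<epsilon>) (a * r)"
  using assms descent_field_scaleR unfolding descent_directions_def by blast

text \<open>The second field is evaluated at the point reached by the first, so the total
  displacement is \<open>t\<close> times the sum of the two velocities; rates and tolerances add up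
  accordingly.\<close>

lemma descent_directions_add:
  assumes Y: "subspace Y" and v: "v \<in> descent_directions Y f u \<epsilon> r" and w: "w \<in> descent_directions Y f u \<epsilon>' r'"
  shows "v + w \<in> descent_directions Y f u (\<epsilon> + \<epsilon>') (r + r')"
proof -
  from v obtain \<delta> \<V> where "descent_field Y f u \<epsilon> r v \<delta> \<V>"
    unfolding descent_directions_def by blast
  note V = descent_fieldD[OF this]
  from w obtain \<delta>' \<W> where "descent_field Y f u \<epsilon>' r' w \<delta>' \<W>"
    unfolding descent_directions_def by blast
  note W = descent_fieldD[OF this]
  note \<delta> = V(1) and \<delta>' = W(1)
  \<comment> \<open>\<open>K\<close> bounds the norm of \<open>\<V>\<close> plus
    \<open>\<bar>r\<bar>\<close>, hence the speed in space and level together. By the choice of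
    \<open>\<eta>\<close> the start is within \<open>\<delta>' / 2\<close> of the centre and the
    displacement is at most \<open>\<delta>' / 2\<close>.\<close>
  define K where "K = norm v + \<bar>\<epsilon>\<bar> + \<bar>r\<bar> + 1"
  have "K \<ge> 1" by (simp add: K_def)
  define \<eta> where "\<eta> = min \<delta> (\<delta>' / (2 * K))"
  have "\<delta>' / (2 * K) \<le> \<delta>' / 2" using \<delta>' \<open>K \<ge> 1\<close> by (intro divide_left_mono) auto
  then have \<eta>: "\<eta> > 0" "\<eta> \<le> \<delta>" "\<eta> \<le> \<delta>' / 2"
    using \<delta> \<delta>' \<open>K \<ge> 1\<close> by (auto simp: \<eta>_def)
  have \<eta>': "t * K \<le> \<delta>' / 2" if "t \<le> \<eta>" for t
    using that \<open>K \<ge> 1\<close> by (auto simp: \<eta>_def field_simps)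
  \<comment> \<open>Flow along \<open>\<V>\<close> for time \<open>t\<close> while the level grows by \<open>r * t\<close>: this stays in the epigraph,
    so \<open>\<W>\<close> can be applied at the new point.\<close>
  define \<Phi> where "\<Phi> p = (fst (fst p) + snd p *\<^sub>R \<V> p, snd (fst p) + r * snd p)" for p
  have step: "\<Phi> ((\<xi>, \<mu>), t) \<in> epi_ball Y f u \<delta>'"
    if a: "(\<xi>, \<mu>) \<in> epi_ball Y f u \<eta>" "0 < t" "t \<le> \<eta>" for \<xi> \<mu> t
  proof -
    have b: "(\<xi>, \<mu>) \<in> epi_ball Y f u \<delta>" "t \<le> \<delta>" using a \<eta> by auto
    note V = V(3-)[OF b(1) a(2) b(2)]
    have "\<xi> \<in> Y" using a by (simp add: epi_def)
    then have epi: "\<Phi> ((\<xi>, \<mu>), t) \<in> epi Y f"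
      using V(1,3) Y by (simp add: \<Phi>_def epi_def subspace_add subspace_scale)
    have "norm (\<V> ((\<xi>, \<mu>), t)) + \<bar>r\<bar> \<le> K"
      using V(2) norm_triangle_sub[of "\<V> ((\<xi>, \<mu>), t)" v]
      by (simp add: K_def dist_norm norm_minus_commute)
    then have "t * (norm (\<V> ((\<xi>, \<mu>), t)) + \<bar>r\<bar>) \<le> t * K" using a(2) by simp
    also have "\<dots> \<le> \<delta>' / 2" using \<eta>' a by simp
    finally have *: "t * norm (\<V> ((\<xi>, \<mu>), t)) + \<bar>r\<bar> * t \<le> \<delta>' / 2" by (simp add: algebra_simps)
    have "norm (t *\<^sub>R \<V> ((\<xi>, \<mu>), t), r * t) \<le> t * norm (\<V> ((\<xi>, \<mu>), t)) + \<bar>r\<bar> * t"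
      using norm_Pair_le[of "t *\<^sub>R \<V> ((\<xi>, \<mu>), t)" "r * t"] a(2) by (simp add: abs_mult)
    with * have "dist (\<Phi> ((\<xi>, \<mu>), t)) (\<xi>, \<mu>) \<le> \<delta>' / 2"
      unfolding \<Phi>_def by (simp only: dist_norm fst_conv snd_conv diff_Pair add_diff_cancel_left')
    moreover have "dist (u, real_of_ereal (f u)) (\<xi>, \<mu>) < \<delta>' / 2" using a(1) \<eta>(3) by simp
    ultimately show ?thesis
      using epi dist_triangle[of "(u, real_of_ereal (f u))" "\<Phi> ((\<xi>, \<mu>), t)" "(\<xi>, \<mu>)"]
      by (simp add: dist_commute)
  qed
  have contV': "continuous_on (epi_ball Y f u \<eta> \<times> {0<..\<eta>}) \<V>"
    by (rule continuous_on_subset[OF V(2)]) (use \<eta> in auto)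
  have "descent_field Y f u (\<epsilon> + \<epsilon>') (r + r') (v + w) \<eta> (\<lambda>p. \<V> p + \<W> (\<Phi> p, snd p))"
  proof (rule descent_fieldI[OF \<eta>(1)])
    show "continuous_on (epi_ball Y f u \<eta> \<times> {0<..\<eta>}) (\<lambda>p. \<V> p + \<W> (\<Phi> p, snd p))"
    proof (intro continuous_on_add contV' continuous_on_compose2[OF W(2)])
      show "continuous_on (epi_ball Y f u \<eta> \<times> {0<..\<eta>}) (\<lambda>p. (\<Phi> p, snd p))"
        unfolding \<Phi>_def by (intro continuous_intros contV')
      show "(\<lambda>p. (\<Phi> p, snd p)) ` (epi_ball Y f u \<eta> \<times> {0<..\<eta>})
          \<subseteq> epi_ball Y f u \<delta>' \<times> {0<..\<delta>'}"
      proof (rule image_subsetI)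
        fix p assume "p \<in> epi_ball Y f u \<eta> \<times> {0<..\<eta>}"
        then obtain \<xi> \<mu> t where p: "p = ((\<xi>, \<mu>), t)" "(\<xi>, \<mu>) \<in> epi_ball Y f u \<eta>" "0 < t" "t \<le> \<eta>"
          by (metis mem_Times_iff surj_pair fst_conv snd_conv greaterThanAtMost_iff)
        then show "(\<Phi> p, snd p) \<in> epi_ball Y f u \<delta>' \<times> {0<..\<delta>'}"
          using step[OF p(2-)] \<eta>(3) \<delta>' by simp
      qed
    qed
    fix \<xi> \<mu> t
    assume a: "(\<xi>, \<mu>) \<in> epi_ball Y f u \<eta>" "0 < t" "t \<le> \<eta>"
    have b: "(\<xi>, \<mu>) \<in> epi_ball Y f u \<delta>" "t \<le> \<delta>" "t \<le> \<delta>'" using a \<eta> \<delta>' by auto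
    note V = V(3-)[OF b(1) a(2) b(2)]
    obtain \<xi>' \<mu>' where \<Phi>: "\<Phi> ((\<xi>, \<mu>), t) = (\<xi>', \<mu>')" by fastforce
    note W = W(3-)[OF step[OF a, unfolded \<Phi>] a(2) b(3)]
    have "\<xi>' = \<xi> + t *\<^sub>R \<V> ((\<xi>, \<mu>), t)" "\<mu>' = \<mu> + r * t" using \<Phi> by (auto simp: \<Phi>_def)
    moreover have "dist (v + w) (\<V> ((\<xi>, \<mu>), t) + \<W> ((\<xi>', \<mu>'), t)) < \<epsilon> + \<epsilon>'"
      using V(2) W(2) dist_triangle_add[of v w "\<V> ((\<xi>, \<mu>), t)" "\<W> ((\<xi>', \<mu>'), t)"] by linarith
    ultimately show "\<V> ((\<xi>, \<mu>), t) + \<W> (\<Phi> ((\<xi>, \<mu>), t), snd ((\<xi>, \<mu>), t)) \<in> Y \<and>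
        dist (v + w) (\<V> ((\<xi>, \<mu>), t) + \<W> (\<Phi> ((\<xi>, \<mu>), t), snd ((\<xi>, \<mu>), t))) < \<epsilon> + \<epsilon>' \<and>
        f (\<xi> + t *\<^sub>R (\<V> ((\<xi>, \<mu>), t) + \<W> (\<Phi> ((\<xi>, \<mu>), t), snd ((\<xi>, \<mu>), t)))) \<le> ereal (\<mu> + (r + r') * t)"
      using V(1) W(1,3) Y \<Phi> by (simp add: subspace_add algebra_simps)
  qed
  then show ?thesis unfolding descent_directions_def by blast
qed

text \<open>Scaling multiplies tolerance and rate by the weights as well; as the weights sum to 1,
  addition returns to the same \<open>\<epsilon>\<close> and \<open>r\<close>.\<close>

lemma convex_descent_directions:
  assumes "subspace Y"
  shows "convex (descent_directions Y f u \<epsilon> r)"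
proof (rule convexI)
  fix v w and a b :: real
  assume v: "v \<in> descent_directions Y f u \<epsilon> r" and w: "w \<in> descent_directions Y f u \<epsilon> r"
    and ab: "0 \<le> a" "0 \<le> b" "a + b = 1"
  show "a *\<^sub>R v + b *\<^sub>R w \<in> descent_directions Y f u \<epsilon> r"
  \<comment> \<open>A vanishing weight is treated apart, scaling being available for positive
    factors only.\<close>
  proof (cases "a = 0 \<or> b = 0")
    case True then show ?thesis using v w ab by auto
  next
    case False
    then have "a *\<^sub>R v + b *\<^sub>R w \<in> descent_directions Y f u (a * \<epsilon> + b * \<epsilon>) (a * r + b * r)"
      using assms v w ab by (intro descent_directions_add descent_directions_scaleR) auto
    then show ?thesis using ab(3) by (simp flip: distrib_right)
  qed
qed

lemma descent_directions_mono:
  assumes "r \<le> r'"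
  shows "descent_directions Y f u \<epsilon> r \<subseteq> descent_directions Y f u \<epsilon> r'"
proof -
  have "descent_field Y f u \<epsilon> r' v \<delta> \<V>" if "descent_field Y f u \<epsilon> r v \<delta> \<V>" for v \<delta> \<V>
  proof (rule descent_fieldI)
    note V = descent_fieldD[OF that]
    show "\<delta> > 0" "continuous_on (epi_ball Y f u \<delta> \<times> {0<..\<delta>}) \<V>" by (fact V)+
    fix \<xi> \<mu> t
    assume a: "(\<xi>, \<mu>) \<in> epi_ball Y f u \<delta>" "0 < t" "t \<le> \<delta>"
    have "ereal (\<mu> + r * t) \<le> ereal (\<mu> + r' * t)" using assms a(2) by simp
    then show "\<V> ((\<xi>, \<mu>), t) \<in> Y \<and> dist v (\<V> ((\<xi>, \<mu>), t)) < \<epsilon> \<and>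
          f (\<xi> + t *\<^sub>R \<V> ((\<xi>, \<mu>), t)) \<le> ereal (\<mu> + r' * t)"
      using V(3-)[OF a] order_trans by blast
  qed
  then show ?thesis unfolding descent_directions_def by blast
qed

text \<open>The field for \<open>w\<close> also serves \<open>v\<close>, by the triangle inequality.
  This allows the passage from a convex hull to its closure.\<close>

lemma descent_directions_perturb:
  assumes "w \<in> descent_directions Y f u \<epsilon> r" and vw: "dist v w \<le> \<epsilon>'"
  shows "v \<in> descent_directions Y f u (\<epsilon> + \<epsilon>') r"
proof -
  have dist: "dist v x < \<epsilon> + \<epsilon>'" if "dist w x < \<epsilon>" for x
    using that vw dist_triangle[of v x w] by linarith
  from assms(1) obtain \<delta> \<V> where "descent_field Y f u \<epsilon> r w \<delta> \<V>"
    unfolding descent_directions_def by blast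
  then have "descent_field Y f u (\<epsilon> + \<epsilon>') r v \<delta> \<V>"
    unfolding descent_field_def using dist by blast
  then show ?thesis unfolding descent_directions_def by blast
qed

section \<open>Descent directions, the generalized derivative and critical points\<close>

lemma gen_deriv_less_imp_descent_directions:
  assumes "gen_deriv Y f u v < ereal r" and "\<epsilon> > 0"
  shows "v \<in> descent_directions Y f u \<epsilon> r"
proof -
  have "gen_deriv_eps Y f \<epsilon> u v \<le> gen_deriv Y f u v"
    unfolding gen_deriv_def using assms(2) by (intro SUP_upper) simp
  then have "Inf {ereal r | r. v \<in> descent_directions Y f u \<epsilon> r} < ereal r"
    using assms(1) by (simp add: gen_deriv_eps_eq)
  then obtain r' where "r' < r" "v \<in> descent_directions Y f u \<epsilon> r'"
    by (auto simp: Inf_less_iff)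
  then show ?thesis using descent_directions_mono[of r' r Y f u \<epsilon>] by auto
qed

lemma gen_deriv_leI:
  assumes "\<And>\<epsilon>. \<epsilon> > 0 \<Longrightarrow> v \<in> descent_directions Y f u \<epsilon> r"
  shows "gen_deriv Y f u v \<le> ereal r"
  unfolding gen_deriv_def gen_deriv_eps_eq
  using assms by (intro SUP_least Inf_lower) auto

lemma zero_in_dual_space: "(\<lambda>v\<in>UNIV. 0) \<in> dual_space UNIV"
  by (simp add: dual_space_def)

lemma critical_pointD: "critical_point Y f u \<Longrightarrow> v \<in> Y \<Longrightarrow> 0 \<le> gen_deriv Y f u v"
  by (auto simp: critical_point_def subdifferential_def zero_ereal_def)

lemma critical_pointI: "(\<And>v. 0 \<le> gen_deriv UNIV f u v) \<Longrightarrow> critical_point UNIV f u"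
  using zero_in_dual_space by (auto simp: critical_point_def subdifferential_def zero_ereal_def)

section \<open>Descent directions and symmetry\<close>

context compact_group_linear_action
begin

text \<open>Conjugate the field: pull the point back by \<open>inv g\<close>, apply
  \<open>\<V>\<close>, push the velocity forward by \<open>\<phi> g\<close>. Invariance of
  \<open>f\<close> preserves the epigraph and the descent inequality; the tolerance is stretched by
  \<open>B\<close>.\<close>

lemma descent_directions_action:
  assumes inv: "\<And>g w. g \<in> carrier G \<Longrightarrow> f (\<phi> g w) = f w" and u: "u \<in> Fix_set G \<phi>"
    and g: "g \<in> carrier G" and B: "B > 0" "\<And>x. norm (\<phi> g x) \<le> B * norm x"
    and v: "v \<in> descent_directions UNIV f u \<epsilon> r"
  shows "\<phi> g v \<in> descent_directions UNIV f u (B * \<epsilon>) r"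
proof -
  from v obtain \<delta> \<V> where "descent_field UNIV f u \<epsilon> r v \<delta> \<V>"
    unfolding descent_directions_def by blast
  note V = descent_fieldD[OF this]
  have h: "inv g \<in> carrier G" using g by simp
  define \<Psi> where "\<Psi> x = (\<phi> (inv g) (fst x), snd x)" for x :: "'x \<times> real"
  have cont: "continuous_on S \<Psi>" for S
    unfolding \<Psi>_def by (intro continuous_intros linear_continuous_on_compose
        bounded_linear.continuous_on[OF bounded_linear_action[OF h]])
  \<comment> \<open>Since \<open>u\<close> is a fixed point, \<open>\<Psi>\<close> leaves the centre
    in place, so by continuity it maps a small ball into the one of radius
    \<open>\<delta>\<close>.\<close>
  have "(u, real_of_ereal (f u)) \<in> \<Psi> -` ball (u, real_of_ereal (f u)) \<delta>"
    using u h V(1) by (simp add: \<Psi>_def Fix_set_def)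
  then obtain \<eta> where \<eta>: "\<eta> > 0" "ball (u, real_of_ereal (f u)) \<eta> \<subseteq> \<Psi> -` ball (u, real_of_ereal (f u)) \<delta>"
    using open_vimage[OF open_ball cont] by (metis openE)
  define \<delta>' where "\<delta>' = min \<delta> \<eta>"
  have \<delta>': "\<delta>' > 0" "\<delta>' \<le> \<delta>" "\<delta>' \<le> \<eta>" using \<eta> V(1) by (auto simp: \<delta>'_def)
  have \<Psi>: "\<Psi> x \<in> epi_ball UNIV f u \<delta>" if "x \<in> epi_ball UNIV f u \<delta>'" for x
  proof -
    have "x \<in> ball (u, real_of_ereal (f u)) \<eta>" using that \<delta>'(3) by auto
    then have "\<Psi> x \<in> ball (u, real_of_ereal (f u)) \<delta>" using \<eta>(2) by blast
    then show ?thesis using that by (auto simp: \<Psi>_def epi_def inv h)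
  qed
  have "descent_field UNIV f u (B * \<epsilon>) r (\<phi> g v) \<delta>' (\<lambda>p. \<phi> g (\<V> (\<Psi> (fst p), snd p)))"
  proof (rule descent_fieldI[OF \<delta>'(1)])
    show "continuous_on (epi_ball UNIV f u \<delta>' \<times> {0<..\<delta>'}) (\<lambda>p. \<phi> g (\<V> (\<Psi> (fst p), snd p)))"
    proof (intro bounded_linear.continuous_on[OF bounded_linear_action[OF g]] continuous_on_compose2[OF V(2)])
      show "continuous_on (epi_ball UNIV f u \<delta>' \<times> {0<..\<delta>'}) (\<lambda>p. (\<Psi> (fst p), snd p))"
        by (intro continuous_on_Pair continuous_on_compose2[OF cont[of UNIV]] continuous_intros) auto
      show "(\<lambda>p. (\<Psi> (fst p), snd p)) ` (epi_ball UNIV f u \<delta>' \<times> {0<..\<delta>'}) \<subseteq> epi_ball UNIV f u \<delta> \<times> {0<..\<delta>}"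
        using \<Psi> \<delta>'(2) by (intro image_subsetI) (simp add: mem_Times_iff del: Int_iff)
    qed
    fix \<xi> \<mu> t
    assume a: "(\<xi>, \<mu>) \<in> epi_ball UNIV f u \<delta>'" "0 < t" "t \<le> \<delta>'"
    have b: "(\<phi> (inv g) \<xi>, \<mu>) \<in> epi_ball UNIV f u \<delta>" using \<Psi>[OF a(1)] by (simp add: \<Psi>_def)
    let ?w = "\<V> ((\<phi> (inv g) \<xi>, \<mu>), t)"
    note V = V(4-)[OF b a(2)]
    have t: "t \<le> \<delta>" using a(3) \<delta>' by simp
    have "dist (\<phi> g v) (\<phi> g ?w) \<le> B * dist v ?w"
      using B(2)[of "v - ?w"] by (simp add: dist_norm linear_diff[OF linear_action[OF g]])
    also have "\<dots> < B * \<epsilon>" using V(1)[OF t] B(1) by simp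
    finally have "dist (\<phi> g v) (\<phi> g ?w) < B * \<epsilon>" .
    moreover have "\<phi> g (\<phi> (inv g) \<xi> + t *\<^sub>R ?w) = \<xi> + t *\<^sub>R \<phi> g ?w"
      by (simp add: linear_add linear_cmul linear_action g action_inv)
    then have "f (\<xi> + t *\<^sub>R \<phi> g ?w) \<le> ereal (\<mu> + r * t)"
      using V(2)[OF t] inv[OF g] by metis
    ultimately show "\<phi> g (\<V> (\<Psi> (fst ((\<xi>, \<mu>), t)), snd ((\<xi>, \<mu>), t))) \<in> UNIV \<and>
        dist (\<phi> g v) (\<phi> g (\<V> (\<Psi> (fst ((\<xi>, \<mu>), t)), snd ((\<xi>, \<mu>), t)))) < B * \<epsilon> \<and>
        f (\<xi> + t *\<^sub>R \<phi> g (\<V> (\<Psi> (fst ((\<xi>, \<mu>), t)), snd ((\<xi>, \<mu>), t)))) \<le> ereal (\<mu> + r * t)"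
      by (simp add: \<Psi>_def)
  qed
  then show ?thesis unfolding descent_directions_def by blast
qed

text \<open>Start from tolerance \<open>\<epsilon> / (2 * B)\<close>: the action stretches it to
  \<open>\<epsilon> / 2\<close> uniformly in \<open>g\<close>, convexity keeps it on the hull of the
  orbit, and approximating the average from the hull spends the other half.\<close>

lemma descent_directions_averaging_map:
  assumes inv: "\<And>g w. g \<in> carrier G \<Longrightarrow> f (\<phi> g w) = f w" and u: "u \<in> Fix_set G \<phi>"
    and v: "\<And>\<epsilon>. \<epsilon> > 0 \<Longrightarrow> v \<in> descent_directions UNIV f u \<epsilon> r" and "\<epsilon> > 0"
  shows "averaging_map \<mu> \<phi> v \<in> descent_directions UNIV f u \<epsilon> r"
proof -
  obtain B where B: "B > 0" "\<And>g x. g \<in> carrier G \<Longrightarrow> norm (\<phi> g x) \<le> B * norm x"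
    using action_bound by blast
  have "\<phi> g v \<in> descent_directions UNIV f u (\<epsilon> / 2) r" if g: "g \<in> carrier G" for g
    using descent_directions_action[OF inv u g B(1) B(2)[OF g] v, of "\<epsilon> / (2 * B)"] B(1) \<open>\<epsilon> > 0\<close> by simp
  then have "convex hull ((\<lambda>g. \<phi> g v) ` carrier G) \<subseteq> descent_directions UNIV f u (\<epsilon> / 2) r"
    by (intro hull_minimal convex_descent_directions) auto
  moreover obtain w where "w \<in> convex hull ((\<lambda>g. \<phi> g v) ` carrier G)" "dist w (averaging_map \<mu> \<phi> v) < \<epsilon> / 2"
    using averaging_map_in_closure_convex_hull[of v] \<open>\<epsilon> > 0\<close> unfolding closure_approachable
    by (meson half_gt_zero)
  ultimately show ?thesis
    using descent_directions_perturb[of w UNIV f u "\<epsilon> / 2" r "averaging_map \<mu> \<phi> v" "\<epsilon> / 2"]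
    by (auto simp: dist_commute)
qed

text \<open>Average the field. If \<open>\<zeta>\<close> is \<open>\<xi>\<close> moved along the
  averaged velocity, then \<open>\<xi> + t *\<^sub>R z\<close> is \<open>\<zeta>\<close> moved by
  \<open>t *\<^sub>R (z - ?A z)\<close>, so the slope hypothesis transfers the decrease along
  \<open>z\<close> to \<open>\<zeta>\<close>; the gap between \<open>r\<close> and \<open>r'\<close>
  absorbs the error.\<close>

lemma descent_directions_Fix_set:
  assumes u: "u \<in> Fix_set G \<phi>" and fu: "\<bar>f u\<bar> \<noteq> \<infinity>" and v: "v \<in> Fix_set G \<phi>"
    and "\<rho> > 0" "C > 0"
    and slope: "\<And>\<zeta> z t. \<zeta> \<in> ball u \<rho> \<inter> Fix_set G \<phi> \<Longrightarrow> z \<in> ball v \<rho> \<Longrightarrow> 0 < t \<Longrightarrow> t \<le> \<rho> \<Longrightarrow>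
      f (\<zeta> - t *\<^sub>R averaging_map \<mu> \<phi> z) \<le> f u + ereal \<rho> \<Longrightarrow>
      f \<zeta> \<le> f (\<zeta> + t *\<^sub>R (z - averaging_map \<mu> \<phi> z)) + ereal (C * t * norm (z - averaging_map \<mu> \<phi> z))"
    and dir: "\<And>\<epsilon>. \<epsilon> > 0 \<Longrightarrow> v \<in> descent_directions UNIV f u \<epsilon> r"
    and "r < r'" "\<epsilon> > 0"
  shows "v \<in> descent_directions (Fix_set G \<phi>) f u \<epsilon> r'"
proof -
  let ?A = "averaging_map \<mu> \<phi>" and ?F = "Fix_set G \<phi>"
  obtain c where c: "f u = ereal c" using fu by auto
  \<comment> \<open>Below, \<open>z\<close> and \<open>?A z\<close> both lie within
    \<open>\<kappa>\<close> of \<open>v\<close>, so their distance costs at most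
    \<open>C * (2 * \<kappa>) = r' - r\<close> per unit of time.\<close>
  define \<kappa> where "\<kappa> = (r' - r) / (2 * C)"
  have \<kappa>: "\<kappa> > 0" "C * (2 * \<kappa>) = r' - r" using \<open>C > 0\<close> \<open>r < r'\<close> by (auto simp: \<kappa>_def)
  have "isCont ?A v" using continuous_on_averaging_map by (simp add: continuous_on_eq_continuous_at)
  then obtain d where d: "d > 0" "\<And>z. dist z v < d \<Longrightarrow> dist (?A z) v < min \<epsilon> \<kappa>"
    using \<kappa>(1) \<open>\<epsilon> > 0\<close> averaging_map_of_Fix_set[OF v]
    unfolding continuous_at_eps_delta by (metis min_less_iff_conj)
  \<comment> \<open>\<open>d\<close> controls the averaged velocity, \<open>\<rho>\<close> admits
    \<open>z\<close> to the slope hypothesis, and \<open>\<kappa>\<close> bounds the error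
    term.\<close>
  define \<eta> where "\<eta> = min d (min \<rho> \<kappa>)"
  have "\<eta> > 0" using d \<kappa> \<open>\<rho> > 0\<close> by (simp add: \<eta>_def)
  from dir[OF this] obtain \<delta> \<V> where "descent_field UNIV f u \<eta> r v \<delta> \<V>"
    unfolding descent_directions_def by blast
  note V = descent_fieldD[OF this]
  \<comment> \<open>The distance from \<open>u\<close> to \<open>\<zeta>\<close> is less than
    \<open>\<delta>'\<close> (to reach \<open>\<xi>\<close>) plus
    \<open>\<delta>' * (norm v + \<epsilon>)\<close> (for the motion), together
    \<open>\<delta>' * K \<le> \<rho>\<close>.\<close>
  define K where "K = 1 + norm v + \<epsilon>"
  have "K \<ge> 1" using \<open>\<epsilon> > 0\<close> by (simp add: K_def)
  define \<delta>' where "\<delta>' = min \<delta> (\<rho> / K)"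
  have "\<delta>' \<le> \<rho> / K" by (simp add: \<delta>'_def)
  moreover have "\<rho> / K \<le> \<rho>" using \<open>K \<ge> 1\<close> \<open>\<rho> > 0\<close> by (simp add: field_simps)
  moreover have "\<delta>' * K \<le> \<rho>"
    using \<open>\<delta>' \<le> \<rho> / K\<close> \<open>K \<ge> 1\<close> by (simp add: pos_le_divide_eq)
  ultimately have \<delta>': "\<delta>' > 0" "\<delta>' \<le> \<delta>" "\<delta>' \<le> \<rho>" "\<delta>' * K \<le> \<rho>"
    using V(1) \<open>K \<ge> 1\<close> \<open>\<rho> > 0\<close> by (auto simp: \<delta>'_def)
  have "descent_field ?F f u \<epsilon> r' v \<delta>' (\<lambda>p. ?A (\<V> p))"
  proof (rule descent_fieldI[OF \<delta>'(1)])
    show "continuous_on (epi_ball ?F f u \<delta>' \<times> {0<..\<delta>'}) (\<lambda>p. ?A (\<V> p))"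
      by (rule continuous_on_compose2[OF continuous_on_averaging_map continuous_on_subset[OF V(2)]])
         (use \<delta>'(2) in \<open>auto simp: epi_def\<close>)
    fix \<xi> \<mu> t
    assume a: "(\<xi>, \<mu>) \<in> epi_ball ?F f u \<delta>'" "0 < t" "t \<le> \<delta>'"
    have b: "(\<xi>, \<mu>) \<in> epi_ball UNIV f u \<delta>" "t \<le> \<delta>" using a \<delta>' by (auto simp: epi_def)
    define z where "z = \<V> ((\<xi>, \<mu>), t)"
    have z: "dist z v < d" "z \<in> ball v \<rho>" "dist z v < \<kappa>"
      using V(4)[OF b(1) a(2) b(2)] by (auto simp: z_def \<eta>_def dist_commute)
    have fz: "f (\<xi> + t *\<^sub>R z) \<le> ereal (\<mu> + r * t)"
      using V(5)[OF b(1) a(2) b(2)] by (simp add: z_def)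
    have Az: "dist (?A z) v < \<epsilon>" "dist (?A z) v < \<kappa>" using d(2)[OF z(1)] by auto
    have \<xi>: "\<xi> \<in> ?F" "f \<xi> \<le> ereal \<mu>" using a by (auto simp: epi_def)
    have dist: "dist (u, c) (\<xi>, \<mu>) < \<delta>'" using a by (simp add: c)
    have "dist u \<xi> < \<delta>'" using dist_fst_le[of "(u, c)" "(\<xi>, \<mu>)"] dist by simp
    have "dist c \<mu> < \<delta>'" using dist_snd_le[of "(u, c)" "(\<xi>, \<mu>)"] dist by simp
    define \<zeta> where "\<zeta> = \<xi> + t *\<^sub>R ?A z"
    have "norm (?A z) \<le> norm v + \<epsilon>"
      using Az(1) norm_triangle_sub[of "?A z" v] by (simp add: dist_norm)
    then have "norm (t *\<^sub>R ?A z) \<le> \<delta>' * (norm v + \<epsilon>)"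
      using a(2,3) by (simp add: mult_mono)
    then have "dist u \<zeta> < \<delta>' * K"
      using \<open>dist u \<xi> < \<delta>'\<close> norm_triangle_ineq4[of "u - \<xi>" "t *\<^sub>R ?A z"]
      by (simp add: \<zeta>_def K_def dist_norm algebra_simps)
    then have \<zeta>: "\<zeta> \<in> ball u \<rho> \<inter> ?F"
      using \<delta>'(4) \<xi>(1) averaging_map_in_Fix_set[of z] subspace_Fix_set
      by (simp add: \<zeta>_def subspace_add subspace_scale)
    \<comment> \<open>Because \<open>\<zeta> - t *\<^sub>R ?A z\<close> is just
      \<open>\<xi>\<close>, the level condition of the slope hypothesis concerns
      \<open>f \<xi>\<close>, which is at most \<open>\<mu> < c + \<delta>'\<close>.\<close>
    have "f \<xi> \<le> ereal (c + \<rho>)"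
      using \<xi>(2) \<open>dist c \<mu> < \<delta>'\<close> \<delta>'(3) by (intro order_trans[OF \<xi>(2)]) (simp add: dist_real_def)
    then have "f \<zeta> \<le> f (\<zeta> + t *\<^sub>R (z - ?A z)) + ereal (C * t * norm (z - ?A z))"
      using a(3) \<delta>'(3) by (intro slope[OF \<zeta> z(2) a(2)]) (auto simp: \<zeta>_def c)
    also have "\<zeta> + t *\<^sub>R (z - ?A z) = \<xi> + t *\<^sub>R z"
      by (simp add: \<zeta>_def algebra_simps)
    also have "f (\<xi> + t *\<^sub>R z) + ereal (C * t * norm (z - ?A z)) \<le> ereal (\<mu> + r * t) + ereal (t * (r' - r))"
    proof (intro add_mono fz)
      have "norm (z - ?A z) \<le> 2 * \<kappa>"
        using z(3) Az(2) dist_triangle2[of z "?A z" v] by (simp add: dist_norm)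
      then have "C * norm (z - ?A z) \<le> r' - r"
        using \<open>C > 0\<close> by (simp flip: \<kappa>(2))
      then have "t * (C * norm (z - ?A z)) \<le> t * (r' - r)" using a(2) by simp
      then show "ereal (C * t * norm (z - ?A z)) \<le> ereal (t * (r' - r))"
        by (simp add: mult.assoc mult.left_commute)
    qed
    also have "\<dots> = ereal (\<mu> + r' * t)" by (simp add: algebra_simps)
    finally show "?A (\<V> ((\<xi>, \<mu>), t)) \<in> ?F \<and> dist v (?A (\<V> ((\<xi>, \<mu>), t))) < \<epsilon> \<and>
        f (\<xi> + t *\<^sub>R ?A (\<V> ((\<xi>, \<mu>), t))) \<le> ereal (\<mu> + r' * t)"
      using averaging_map_in_Fix_set Az(1) by (simp add: \<zeta>_def z_def dist_commute)
  qed
  then show ?thesis unfolding descent_directions_def by blast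
qed

end

section \<open>Transfer of a negative derivative to the fixed point space\<close>

theorem theorem3p2:
  fixes G :: "('g, 'm) monoid_scheme" and T :: "'g topology" and n :: nat
    and \<A> :: "('g set \<times> ('g \<Rightarrow> nat \<Rightarrow> real)) set"
    and \<mu> :: "'g measure"
    and \<phi> :: "'g \<Rightarrow> 'x \<Rightarrow> 'x::banach"
    and A :: "'x \<Rightarrow> 'x"
    and f :: "'x \<Rightarrow> ereal" and u :: 'x
  assumes "compact_lie_group G T n \<A>"
    and "acts_linearly G T \<phi>"
    and "normalized_haar_measure G T \<mu>"
    and "A = averaging_map \<mu> \<phi>"
    and "\<And>g w. g \<in> carrier G \<Longrightarrow> f (\<phi> g w) = f w"
    and "\<forall>u\<in>Fix_set G \<phi>. \<forall>v\<in>Fix_set G \<phi>. \<exists>\<rho>>0. \<exists>C>0.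
           \<forall>\<zeta> \<in> ball u \<rho> \<inter> Fix_set G \<phi>. \<forall>z \<in> ball v \<rho>. \<forall>t\<in>{0<..\<rho>}.
             f (\<zeta> - t *\<^sub>R A z) \<le> f u + ereal \<rho> \<longrightarrow>
             f \<zeta> \<le> f (\<zeta> + t *\<^sub>R (z - A z)) + ereal (C * t * norm (z - A z))"
    and "u \<in> Fix_set G \<phi>" and "\<bar>f u\<bar> \<noteq> \<infinity>"
    and "critical_point (Fix_set G \<phi>) f u"
  shows "critical_point UNIV f u"
proof (rule critical_pointI, rule ccontr)
  fix v
  assume "\<not> 0 \<le> gen_deriv UNIV f u v"
  \<comment> \<open>A real rate strictly between the derivative and 0 is admissible for
    \<open>v\<close> at every tolerance.\<close>
  then obtain r where r: "gen_deriv UNIV f u v < ereal r" "r < 0"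
    using ereal_dense2[of "gen_deriv UNIV f u v" 0] by (auto simp: not_le)
  interpret compact_lie_group G T n \<A> by fact
  interpret compact_group_linear_action G T \<mu> \<phi>
    by unfold_locales (use assms topspace_eq compact continuous_mult in auto)
  have Av: "A v \<in> Fix_set G \<phi>" by (simp add: assms(4) averaging_map_in_Fix_set)
  have "v \<in> descent_directions UNIV f u \<epsilon> r" if "\<epsilon> > 0" for \<epsilon>
    using r(1) that by (rule gen_deriv_less_imp_descent_directions)
  then have dir: "A v \<in> descent_directions UNIV f u \<epsilon> r" if "\<epsilon> > 0" for \<epsilon>
    using descent_directions_averaging_map[OF assms(5,7) _ that] by (simp add: assms(4))
  obtain \<rho> C where "\<rho> > 0" "C > 0" and
    slope: "\<forall>\<zeta> \<in> ball u \<rho> \<inter> Fix_set G \<phi>. \<forall>z \<in> ball (A v) \<rho>. \<forall>t\<in>{0<..\<rho>}.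
             f (\<zeta> - t *\<^sub>R A z) \<le> f u + ereal \<rho> \<longrightarrow>
             f \<zeta> \<le> f (\<zeta> + t *\<^sub>R (z - A z)) + ereal (C * t * norm (z - A z))"
    using assms(6)[rule_format, OF assms(7) Av] by blast
  \<comment> \<open>\<open>r / 2\<close> exceeds \<open>r\<close>, leaving room for the averaging
    error, and is still negative, against criticality of the restriction.\<close>
  have "gen_deriv (Fix_set G \<phi>) f u (A v) \<le> ereal (r / 2)"
  proof (rule gen_deriv_leI)
    fix \<epsilon> :: real assume "\<epsilon> > 0"
    then show "A v \<in> descent_directions (Fix_set G \<phi>) f u \<epsilon> (r / 2)"
      using slope r(2) assms(4)
      by (intro descent_directions_Fix_set[OF assms(7,8) Av \<open>\<rho> > 0\<close> \<open>C > 0\<close> _ dir]) auto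
  qed
  moreover have "0 \<le> gen_deriv (Fix_set G \<phi>) f u (A v)"
    by (rule critical_pointD[OF assms(9) Av])
  ultimately have "0 \<le> ereal (r / 2)" by (rule order_trans[rotated])
  then show False using r(2) by simp
qed

end
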